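(* Let $(\Omega,\mu)$ be a probability space, let $W$ be the shift operator on $L^2(S^1)$, $(Wf)(z)=zf(z)$, and let $$Z(W)=\{A\in\mathcal{R}: A(\omega)W=WA(\omega)\text{ for all }\omega\in\Omega\},$$ where $\mathcal{R}$ is the set of all random linear operators from $\Omega$ to $\mathcal{L}(L^2(S^1))$. Then $$Z(W)=\{L^\varphi\},$$ where $\varphi$ runs through all measurable functions $\varphi:\Omega\times S^1\to\mathbb{C}$ such that $\varphi_\omega$ is bounded for every $\omega\in\Omega$.
   Context: $S^1$ is the unit circle in $\mathbb{C}$ and $L^2(S^1)$ is the Hilbert space of square integrable complex-valued functions on $S^1$ with respect to Lebesgue measure on the Borel sets. For a Hilbert space $H$, $\mathcal{L}(H)$ is the algebra of bounded linear operators on $H$. A random linear operator is a map $\Phi:\Omega\to\mathcal{L}(H)$ such that for all $x,y\in H$ the map $\Omega\to\mathbb{C}$, $\omega\mapsto\langle\Phi(\omega)x,y\rangle$, is measurable. For $\varphi:\Omega\times S^1\to\mathbb{C}$ measurable with respect to the product measure, $\varphi_\omega:S^1\to\mathbb{C}$ denotes $\varphi_\omega(z)=\varphi(\omega,z)$. If every $\varphi_\omega$ is bounded, the Laurent operator defined by $\varphi$ is the map $L^\varphi:\Omega\to\mathcal{L}(L^2(S^1))$ given by $L^\varphi_\omega f=\varphi_\omega f$ for $f\in L^2(S^1)$, $\omega\in\Omega$. *)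

theory Defs
  imports "HOL-Probability.Probability"
begin

section \<open>The circle and its square integrable functions\<close>

text \<open>
  Arc length on the Borel sets of the unit circle. The measure has total mass \<open>2 * pi\<close>;
  normalising it would only rescale inner products and norms by a constant.
\<close>

definition circle :: "complex measure" where
  "circle = distr (restrict_space lborel {0..<2*pi}) (restrict_space borel (sphere 0 1)) cis"

lemma space_circle [simp]: "space circle = sphere 0 1"
  by (simp add: circle_def space_restrict_space)

lemma sets_circle: "sets circle = sets (restrict_space borel (sphere 0 1))"
  by (simp add: circle_def)

lemma cis_measurable_circle:
  "cis \<in> restrict_space lborel {0..<2*pi} \<rightarrow>\<^sub>M restrict_space borel (sphere 0 1)"
proof (rule measurable_restrict_space2)
  have "cis \<in> borel_measurable borel"
    by (intro borel_measurable_continuous_onI continuous_intros)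
  then show "cis \<in> borel_measurable (restrict_space lborel {0..<2*pi})"
    by (intro measurable_restrict_space1) simp
qed (auto simp: space_restrict_space)

lemma emeasure_circle: "emeasure circle (space circle) = ennreal (2 * pi)"
proof -
  have "emeasure circle (space circle)
      = emeasure (restrict_space lborel {0..<2*pi}) (cis -` sphere 0 1 \<inter> {0..<2*pi})"
    unfolding circle_def
    by (subst emeasure_distr[OF cis_measurable_circle])
       (auto simp: space_restrict_space sets_restrict_space)
  also have "cis -` sphere 0 1 \<inter> {0..<2*pi} = {0..<2*pi}"
    by auto
  also have "emeasure (restrict_space lborel {0..<2*pi}) {0..<2*pi} = ennreal (2 * pi)"
    by (subst emeasure_restrict_space) auto
  finally show ?thesis .
qed

lemma finite_measure_circle: "finite_measure circle"
  by (rule finite_measureI) (simp add: emeasure_circle del: space_circle)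

definition square_integrable :: "(complex \<Rightarrow> complex) \<Rightarrow> bool" where
  "square_integrable f \<longleftrightarrow>
     f \<in> borel_measurable circle \<and> integrable circle (\<lambda>z. (cmod (f z))\<^sup>2)"

lemma square_integrable_measurable [measurable_dest]:
  "square_integrable f \<Longrightarrow> f \<in> borel_measurable circle"
  by (simp add: square_integrable_def)

lemma square_integrable_zero: "square_integrable (\<lambda>_. 0)"
  by (simp add: square_integrable_def)

lemma square_integrable_add:
  assumes f: "square_integrable f" and g: "square_integrable g"
  shows "square_integrable (\<lambda>z. f z + g z)"
  unfolding square_integrable_def
proof
  have [measurable]: "f \<in> borel_measurable circle" "g \<in> borel_measurable circle"
    using f g by (auto simp: square_integrable_def)
  show "(\<lambda>z. f z + g z) \<in> borel_measurable circle"
    by measurable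
  have "integrable circle (\<lambda>z. 2 * (cmod (f z))\<^sup>2 + 2 * (cmod (g z))\<^sup>2)"
    using f g by (auto simp: square_integrable_def)
  then show "integrable circle (\<lambda>z. (cmod (f z + g z))\<^sup>2)"
  proof (rule Bochner_Integration.integrable_bound)
    show "AE z in circle. norm ((cmod (f z + g z))\<^sup>2)
        \<le> norm (2 * (cmod (f z))\<^sup>2 + 2 * (cmod (g z))\<^sup>2)"
    proof (rule AE_I2)
      fix z
      have "(cmod (f z + g z))\<^sup>2 \<le> (cmod (f z) + cmod (g z))\<^sup>2"
        by (intro power_mono norm_triangle_ineq) auto
      also have "\<dots> \<le> 2 * (cmod (f z))\<^sup>2 + 2 * (cmod (g z))\<^sup>2"
        using sum_squares_bound[of "cmod (f z)" "cmod (g z)"]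
        by (simp add: power2_sum)
      finally show "norm ((cmod (f z + g z))\<^sup>2)
          \<le> norm (2 * (cmod (f z))\<^sup>2 + 2 * (cmod (g z))\<^sup>2)"
        by simp
    qed
  qed measurable
qed

lemma square_integrable_mult_bounded:
  assumes g: "g \<in> borel_measurable circle" "bounded (g ` sphere 0 1)"
    and f: "square_integrable f"
  shows "square_integrable (\<lambda>z. g z * f z)"
  unfolding square_integrable_def
proof
  have [measurable]: "f \<in> borel_measurable circle" "g \<in> borel_measurable circle"
    using f g by (auto simp: square_integrable_def)
  show "(\<lambda>z. g z * f z) \<in> borel_measurable circle"
    by measurable
  obtain B where B: "\<And>z. z \<in> sphere 0 1 \<Longrightarrow> cmod (g z) \<le> B"
    using g(2) unfolding bounded_iff by blast
  have "integrable circle (\<lambda>z. B\<^sup>2 * (cmod (f z))\<^sup>2)"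
    using f by (auto simp: square_integrable_def)
  then show "integrable circle (\<lambda>z. (cmod (g z * f z))\<^sup>2)"
  proof (rule Bochner_Integration.integrable_bound)
    show "AE z in circle. norm ((cmod (g z * f z))\<^sup>2) \<le> norm (B\<^sup>2 * (cmod (f z))\<^sup>2)"
    proof (rule AE_I2)
      fix z assume "z \<in> space circle"
      then have "(cmod (g z))\<^sup>2 \<le> B\<^sup>2"
        using B[of z] by (intro power_mono) auto
      then show "norm ((cmod (g z * f z))\<^sup>2) \<le> norm (B\<^sup>2 * (cmod (f z))\<^sup>2)"
        by (simp add: norm_mult power_mult_distrib mult_right_mono)
    qed
  qed measurable
qed

lemma square_integrable_cmult:
  "square_integrable f \<Longrightarrow> square_integrable (\<lambda>z. c * f z)"
  by (rule square_integrable_mult_bounded) (auto simp: bounded_iff)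

lemma square_integrable_uminus: "square_integrable f \<Longrightarrow> square_integrable (\<lambda>z. - f z)"
  using square_integrable_cmult[of f "-1"] by simp

lemma square_integrable_diff:
  "square_integrable f \<Longrightarrow> square_integrable g \<Longrightarrow> square_integrable (\<lambda>z. f z - g z)"
  using square_integrable_add[of f "\<lambda>z. - g z"] square_integrable_uminus[of g] by simp

lemma integrable_mult_cnj:
  assumes f: "square_integrable f" and g: "square_integrable g"
  shows "integrable circle (\<lambda>z. f z * cnj (g z))"
proof -
  have [measurable]: "f \<in> borel_measurable circle" "g \<in> borel_measurable circle"
    using f g by (auto simp: square_integrable_def)
  have [measurable]: "cnj \<in> borel_measurable borel"
    by (intro borel_measurable_continuous_onI continuous_intros)
  have "integrable circle (\<lambda>z. (cmod (f z))\<^sup>2 + (cmod (g z))\<^sup>2)"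
    using f g by (auto simp: square_integrable_def)
  then show ?thesis
  proof (rule Bochner_Integration.integrable_bound)
    show "AE z in circle. norm (f z * cnj (g z)) \<le> norm ((cmod (f z))\<^sup>2 + (cmod (g z))\<^sup>2)"
    proof (rule AE_I2)
      fix z
      have "0 \<le> cmod (f z) * cmod (g z)"
        by simp
      then have "cmod (f z) * cmod (g z) \<le> (cmod (f z))\<^sup>2 + (cmod (g z))\<^sup>2"
        using sum_squares_bound[of "cmod (f z)" "cmod (g z)"] by linarith
      then show "norm (f z * cnj (g z)) \<le> norm ((cmod (f z))\<^sup>2 + (cmod (g z))\<^sup>2)"
        by (simp add: norm_mult)
    qed
  qed measurable
qed


section \<open>The Hilbert space of square integrable functions modulo null sets\<close>

definition l2_rel :: "(complex \<Rightarrow> complex) \<Rightarrow> (complex \<Rightarrow> complex) \<Rightarrow> bool" where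
  "l2_rel f g \<longleftrightarrow>
     square_integrable f \<and> square_integrable g \<and> (AE z in circle. f z = g z)"

lemma part_equivp_l2_rel: "part_equivp l2_rel"
proof (rule part_equivpI)
  show "\<exists>f. l2_rel f f"
    using square_integrable_zero by (auto simp: l2_rel_def)
  show "symp l2_rel"
    by (simp add: l2_rel_def symp_def eq_commute)
  show "transp l2_rel"
  proof (rule transpI)
    fix f g h assume "l2_rel f g" "l2_rel g h"
    then have "AE z in circle. f z = g z" "AE z in circle. g z = h z"
      by (simp_all add: l2_rel_def)
    then have "AE z in circle. f z = h z" by eventually_elim simp
    then show "l2_rel f h"
      using \<open>l2_rel f g\<close> \<open>l2_rel g h\<close> by (simp add: l2_rel_def)
  qed
qed

quotient_type l2_circle = "complex \<Rightarrow> complex" / partial: l2_rel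
  by (rule part_equivp_l2_rel)

lift_definition cinner :: "l2_circle \<Rightarrow> l2_circle \<Rightarrow> complex" is
  "\<lambda>f g. LINT z|circle. f z * cnj (g z)"
  by (intro integral_cong_AE borel_measurable_integrable integrable_mult_cnj)
     (auto simp: l2_rel_def)

lift_definition scaleC :: "complex \<Rightarrow> l2_circle \<Rightarrow> l2_circle" is
  "\<lambda>c f z. c * f z"
  by (auto simp: l2_rel_def square_integrable_cmult)

instantiation l2_circle :: real_vector
begin

lift_definition zero_l2_circle :: l2_circle is "\<lambda>_. 0"
  by (simp add: l2_rel_def square_integrable_zero)

lift_definition plus_l2_circle :: "l2_circle \<Rightarrow> l2_circle \<Rightarrow> l2_circle" is
  "\<lambda>f g z. f z + g z"
  by (auto simp: l2_rel_def square_integrable_add)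

lift_definition uminus_l2_circle :: "l2_circle \<Rightarrow> l2_circle" is "\<lambda>f z. - f z"
  by (auto simp: l2_rel_def square_integrable_uminus)

lift_definition minus_l2_circle :: "l2_circle \<Rightarrow> l2_circle \<Rightarrow> l2_circle" is
  "\<lambda>f g z. f z - g z"
  by (auto simp: l2_rel_def square_integrable_diff)

definition scaleR_l2_circle :: "real \<Rightarrow> l2_circle \<Rightarrow> l2_circle" where
  "scaleR_l2_circle r f = scaleC (complex_of_real r) f"

instance
proof
  fix f g h :: l2_circle and a b :: real
  show "f + g + h = f + (g + h)"
    by transfer (auto simp: l2_rel_def add.assoc square_integrable_add)
  show "f + g = g + f"
    by transfer (auto simp: l2_rel_def add.commute square_integrable_add)
  show "0 + f = f"
    by transfer (auto simp: l2_rel_def)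
  show "- f + f = 0"
    by transfer (auto simp: l2_rel_def square_integrable_zero)
  show "f - g = f + - g"
    by transfer (auto simp: l2_rel_def square_integrable_diff)
  show "a *\<^sub>R (f + g) = a *\<^sub>R f + a *\<^sub>R g"
    unfolding scaleR_l2_circle_def
    by transfer (auto simp: l2_rel_def distrib_left square_integrable_add square_integrable_cmult)
  show "(a + b) *\<^sub>R f = a *\<^sub>R f + b *\<^sub>R f"
    unfolding scaleR_l2_circle_def
    by transfer (auto simp: l2_rel_def distrib_right square_integrable_add square_integrable_cmult)
  show "a *\<^sub>R b *\<^sub>R f = (a * b) *\<^sub>R f"
    unfolding scaleR_l2_circle_def
    by transfer (auto simp: l2_rel_def mult.assoc square_integrable_cmult)
  show "1 *\<^sub>R f = f"
    unfolding scaleR_l2_circle_def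
    by transfer (auto simp: l2_rel_def)
qed

end

lemma cinner_commute: "cinner g f = cnj (cinner f g)"
proof transfer
  fix g f :: "complex \<Rightarrow> complex"
  have "cnj (LINT z|circle. f z * cnj (g z)) = (LINT z|circle. cnj (f z * cnj (g z)))"
    by (rule Bochner_Integration.integral_cnj[symmetric])
  then show "(LINT z|circle. g z * cnj (f z)) = cnj (LINT z|circle. f z * cnj (g z))"
    by (simp add: mult.commute)
qed

lemma cinner_add_left: "cinner (f + g) h = cinner f h + cinner g h"
proof transfer
  fix f g h assume "l2_rel f f" "l2_rel g g" "l2_rel h h"
  then have "integrable circle (\<lambda>z. f z * cnj (h z))" "integrable circle (\<lambda>z. g z * cnj (h z))"
    by (simp_all add: l2_rel_def integrable_mult_cnj)
  then show "(LINT z|circle. (f z + g z) * cnj (h z))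
      = (LINT z|circle. f z * cnj (h z)) + (LINT z|circle. g z * cnj (h z))"
    by (simp only: distrib_right Bochner_Integration.integral_add)
qed

lemma cinner_scaleC_left: "cinner (scaleC c f) g = c * cinner f g"
  by transfer (simp add: mult.assoc)

lemma cinner_self: "cinner f f = complex_of_real (Re (cinner f f))" "0 \<le> Re (cinner f f)"
proof -
  have "\<exists>r\<ge>0. cinner f f = complex_of_real r"
  proof (transfer)
    fix f
    have "(LINT z|circle. f z * cnj (f z)) = complex_of_real (LINT z|circle. (cmod (f z))\<^sup>2)"
      by (simp only: complex_norm_square[symmetric] integral_complex_of_real)
    then show "\<exists>r\<ge>0. (LINT z|circle. f z * cnj (f z)) = complex_of_real r"
      by (intro exI[of _ "LINT z|circle. (cmod (f z))\<^sup>2"]) auto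
  qed
  then show "cinner f f = complex_of_real (Re (cinner f f))" "0 \<le> Re (cinner f f)"
    by auto
qed

lemma cinner_self_eq_0: "Re (cinner f f) = 0 \<longleftrightarrow> f = 0"
proof transfer
  fix f assume "l2_rel f f"
  then have f: "square_integrable f" by (simp add: l2_rel_def)
  have "(LINT z|circle. f z * cnj (f z)) = complex_of_real (LINT z|circle. (cmod (f z))\<^sup>2)"
    by (simp only: complex_norm_square[symmetric] integral_complex_of_real)
  then have "Re (LINT z|circle. f z * cnj (f z)) = (LINT z|circle. (cmod (f z))\<^sup>2)"
    by simp
  also have "\<dots> = 0 \<longleftrightarrow> (AE z in circle. (cmod (f z))\<^sup>2 = 0)"
    using f by (intro integral_nonneg_eq_0_iff_AE) (auto simp: square_integrable_def)
  finally show "Re (LINT z|circle. f z * cnj (f z)) = 0 \<longleftrightarrow> l2_rel f (\<lambda>_. 0)"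
    using f by (simp add: l2_rel_def square_integrable_zero)
qed

instantiation l2_circle :: real_inner
begin

definition inner_l2_circle :: "l2_circle \<Rightarrow> l2_circle \<Rightarrow> real" where
  "inner_l2_circle f g = Re (cinner f g)"

definition norm_l2_circle :: "l2_circle \<Rightarrow> real" where
  "norm_l2_circle f = sqrt (inner f f)"

definition sgn_l2_circle :: "l2_circle \<Rightarrow> l2_circle" where
  "sgn_l2_circle f = f /\<^sub>R norm f"

definition dist_l2_circle :: "l2_circle \<Rightarrow> l2_circle \<Rightarrow> real" where
  "dist_l2_circle f g = norm (f - g)"

definition uniformity_l2_circle :: "(l2_circle \<times> l2_circle) filter" where
  "uniformity_l2_circle = (INF e\<in>{0<..}. principal {(f, g). dist f g < e})"

definition open_l2_circle :: "l2_circle set \<Rightarrow> bool" where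
  "open_l2_circle U \<longleftrightarrow> (\<forall>f\<in>U. eventually (\<lambda>(f', g). f' = f \<longrightarrow> g \<in> U) uniformity)"

instance
proof
  fix f g h :: l2_circle and r :: real and U :: "l2_circle set"
  show "inner f g = inner g f"
    unfolding inner_l2_circle_def by (subst cinner_commute) simp
  show "inner (f + g) h = inner f h + inner g h"
    by (simp add: inner_l2_circle_def cinner_add_left)
  show "inner (r *\<^sub>R f) g = r * inner f g"
    by (simp add: inner_l2_circle_def scaleR_l2_circle_def cinner_scaleC_left)
  show "0 \<le> inner f f" "inner f f = 0 \<longleftrightarrow> f = 0"
    by (simp_all add: inner_l2_circle_def cinner_self(2) cinner_self_eq_0)
qed (simp_all add: norm_l2_circle_def sgn_l2_circle_def dist_l2_circle_def
      uniformity_l2_circle_def open_l2_circle_def)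

end

lemma norm_abs_l2_circle:
  assumes "square_integrable f"
  shows "norm (abs_l2_circle f) = sqrt (LINT z|circle. (cmod (f z))\<^sup>2)"
proof -
  have "l2_rel f f" using assms by (simp add: l2_rel_def)
  then have "cinner (abs_l2_circle f) (abs_l2_circle f) = (LINT z|circle. f z * cnj (f z))"
    by (simp add: cinner.abs_eq)
  also have "\<dots> = complex_of_real (LINT z|circle. (cmod (f z))\<^sup>2)"
    by (simp only: complex_norm_square[symmetric] integral_complex_of_real)
  finally show ?thesis
    by (simp add: norm_l2_circle_def inner_l2_circle_def)
qed


section \<open>Random linear operators\<close>

definition bounded_operators :: "(l2_circle \<Rightarrow> l2_circle) set" where
  "bounded_operators =
     {T. bounded_linear T \<and> (\<forall>c f. T (scaleC c f) = scaleC c (T f))}"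

text \<open>
  Maps on the probability space are extensional functions, so that equality of two random
  operators means equality at every point of \<open>space M\<close>.
\<close>

definition random_operators :: "'a measure \<Rightarrow> ('a \<Rightarrow> l2_circle \<Rightarrow> l2_circle) set" where
  "random_operators M =
     {A \<in> space M \<rightarrow>\<^sub>E bounded_operators.
        \<forall>x y. (\<lambda>\<omega>. cinner (A \<omega> x) y) \<in> borel_measurable M}"

text \<open>
  Multiplication acts on the chosen representative of a class. When \<open>g\<close> is measurable and
  bounded on the circle, the result does not depend on that choice; no meaning is attached
  to other \<open>g\<close>.
\<close>

definition mult_l2 :: "(complex \<Rightarrow> complex) \<Rightarrow> l2_circle \<Rightarrow> l2_circle" where
  "mult_l2 g f = abs_l2_circle (\<lambda>z. g z * rep_l2_circle f z)"

lemma mult_l2_abs: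
  assumes g: "g \<in> borel_measurable circle" "bounded (g ` sphere 0 1)"
    and f: "square_integrable f"
  shows "mult_l2 g (abs_l2_circle f) = abs_l2_circle (\<lambda>z. g z * f z)"
proof -
  have "l2_rel f f" using f by (simp add: l2_rel_def)
  then have rel: "l2_rel (rep_l2_circle (abs_l2_circle f)) f"
    by (rule Quotient3_rep_abs[OF Quotient3_l2_circle])
  then have "l2_rel (\<lambda>z. g z * rep_l2_circle (abs_l2_circle f) z) (\<lambda>z. g z * f z)"
    using g by (auto simp: l2_rel_def square_integrable_mult_bounded)
  then show ?thesis
    unfolding mult_l2_def by (rule Quotient3_rel_abs[OF Quotient3_l2_circle])
qed

definition circle_shift :: "l2_circle \<Rightarrow> l2_circle" where
  "circle_shift = mult_l2 (\<lambda>z. z)"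

definition random_commutant :: "'a measure \<Rightarrow> (l2_circle \<Rightarrow> l2_circle) \<Rightarrow> ('a \<Rightarrow> l2_circle \<Rightarrow> l2_circle) set" where
  "random_commutant M W = {A \<in> random_operators M. \<forall>\<omega>\<in>space M. A \<omega> \<circ> W = W \<circ> A \<omega>}"

definition laurent :: "'a measure \<Rightarrow> ('a \<times> complex \<Rightarrow> complex) \<Rightarrow> 'a \<Rightarrow> l2_circle \<Rightarrow> l2_circle" where
  "laurent M \<phi> = (\<lambda>\<omega>\<in>space M. mult_l2 (\<lambda>z. \<phi> (\<omega>, z)))"

end

theory Submission imports Defs begin

text \<open>
  An operator commuting with the unitary \<open>W\<close> commutes with multiplication by \<open>z\<close> and \<open>cnj z\<close>. The
  symbols \<open>g\<close> for which it commutes with multiplication by \<open>g\<close> are closed under sums, products and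
  bounded pointwise limits, so by Stone-Weierstrass and a Dynkin argument they include all bounded
  measurable functions. Hence \<open>A \<omega>\<close> is multiplication by \<open>h \<omega> = A \<omega> 1\<close>, and the operator
  bound makes \<open>h \<omega>\<close> essentially bounded.

  The map \<open>h\<close> is only weakly measurable. To represent it by a jointly measurable function, choose from
  a countable dense set of functions, measurably in \<open>\<omega>\<close>, one within \<open>2\<^sup>-\<^sup>n\<close> of \<open>h \<omega>\<close>; the rate
  of convergence forces convergence almost everywhere for each single \<open>\<omega>\<close>. Since
  the essential supremum is itself measurable in \<open>\<omega>\<close>, the limit can finally be truncated to a function
  bounded at every \<open>\<omega>\<close>.
\<close>

section \<open>Bounded measurable functions on the circle\<close>

text \<open>The bound holds at every point of the circle, not just almost everywhere: this is the
  condition on \<open>\<phi>\<close> in the theorem, and under it \<open>mult_l2\<close> is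
  independent of the representative.\<close>

definition circle_bounded :: "(complex \<Rightarrow> complex) \<Rightarrow> bool" where
  "circle_bounded g \<longleftrightarrow> g \<in> borel_measurable circle \<and> bounded (g ` sphere 0 1)"

lemma circle_boundedI:
  assumes "g \<in> borel_measurable circle" "\<And>z. cmod z = 1 \<Longrightarrow> cmod (g z) \<le> B"
  shows "circle_bounded g"
  unfolding circle_bounded_def bounded_iff using assms by fastforce

lemma circle_boundedE:
  assumes "circle_bounded g"
  obtains B where "\<And>z. cmod z = 1 \<Longrightarrow> cmod (g z) \<le> B" "B > 0"
proof -
  obtain B where "\<And>z. cmod z = 1 \<Longrightarrow> cmod (g z) \<le> B"
    using assms unfolding circle_bounded_def bounded_iff by (metis imageI mem_sphere_0)
  then show ?thesis
    using that[of "max B 1"] by fastforce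
qed

lemma circle_bounded_measurable [measurable_dest]:
  "circle_bounded g \<Longrightarrow> g \<in> borel_measurable circle"
  by (simp add: circle_bounded_def)

text \<open>The circle is closed in the plane, so its measurable sets are Borel sets of the plane;
  level sets of simple functions on the circle thus fall under
  \<open>indicator_borel\<close>.\<close>

lemma sets_circle_eq: "sets circle = {B. B \<in> sets borel \<and> B \<subseteq> sphere 0 1}"
  unfolding sets_circle set_eq_iff by (simp add: sets_restrict_space_iff conj_commute)

lemma borel_measurable_circleI: "f \<in> borel_measurable borel \<Longrightarrow> f \<in> borel_measurable circle"
  by (simp add: measurable_restrict_space1 cong: measurable_cong_sets[OF sets_circle refl])

lemma circle_bounded_continuous:
  assumes "continuous_on UNIV g"
  shows "circle_bounded g"
  unfolding circle_bounded_def
proof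
  show "g \<in> borel_measurable circle"
    using assms by (intro borel_measurable_circleI borel_measurable_continuous_onI)
  show "bounded (g ` sphere 0 1)"
    using assms by (intro compact_imp_bounded compact_continuous_image)
      (auto intro: continuous_on_subset)
qed

lemma circle_bounded_const: "circle_bounded (\<lambda>_. c)"
  by (auto intro!: circle_bounded_continuous continuous_intros)

lemma circle_bounded_id: "circle_bounded (\<lambda>z. z)"
  by (auto intro!: circle_bounded_continuous continuous_intros)

lemma circle_bounded_cnj: "circle_bounded cnj"
  by (auto intro!: circle_bounded_continuous continuous_intros)

lemma circle_bounded_real_polynomial:
  "real_polynomial_function p \<Longrightarrow> circle_bounded (\<lambda>z. complex_of_real (p z))"
  by (intro circle_bounded_continuous continuous_on_of_real continuous_at_imp_continuous_on)
    (auto intro: continuous_real_polymonial_function)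

lemma circle_bounded_add:
  assumes "circle_bounded f" "circle_bounded g"
  shows "circle_bounded (\<lambda>z. f z + g z)"
proof -
  obtain B C where "\<And>z. cmod z = 1 \<Longrightarrow> cmod (f z) \<le> B" "\<And>z. cmod z = 1 \<Longrightarrow> cmod (g z) \<le> C"
    using assms by (metis circle_boundedE)
  then show ?thesis
    using assms by (intro circle_boundedI[where B = "B + C"])
      (auto intro!: norm_triangle_mono borel_measurable_add circle_bounded_measurable)
qed

lemma circle_bounded_mult:
  assumes "circle_bounded f" "circle_bounded g"
  shows "circle_bounded (\<lambda>z. f z * g z)"
proof -
  obtain B C where "\<And>z. cmod z = 1 \<Longrightarrow> cmod (f z) \<le> B" "\<And>z. cmod z = 1 \<Longrightarrow> cmod (g z) \<le> C"
      "B \<ge> 0" "C \<ge> 0"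
    using assms by (metis circle_boundedE less_imp_le)
  then show ?thesis
    using assms by (intro circle_boundedI[where B = "B * C"])
      (auto simp: norm_mult intro!: mult_mono borel_measurable_times circle_bounded_measurable)
qed

lemma circle_bounded_indicator:
  assumes "B \<in> sets borel"
  shows "circle_bounded (indicator B)"
  using assms
  by (intro circle_boundedI[where B = 1] borel_measurable_circleI) (auto simp: indicator_def)

section \<open>Monotone class argument for functions on the circle\<close>

text \<open>The closure properties are abstracted for two uses: symbols whose multiplication
  commutes with an operator, and symbols whose multiplication preserves the closure of the
  polynomials. Conjugation is among the generators because polynomials in \<open>z\<close> alone are
  not uniformly dense in the continuous functions on the circle.\<close>

locale circle_function_class =
  fixes P :: "(complex \<Rightarrow> complex) \<Rightarrow> bool"
  assumes class_const: "P (\<lambda>_. c)"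
    and class_id: "P (\<lambda>z. z)"
    and class_cnj: "P cnj"
    and class_add: "circle_bounded f \<Longrightarrow> circle_bounded g \<Longrightarrow> P f \<Longrightarrow> P g \<Longrightarrow> P (\<lambda>z. f z + g z)"
    and class_mult: "circle_bounded f \<Longrightarrow> circle_bounded g \<Longrightarrow> P f \<Longrightarrow> P g \<Longrightarrow> P (\<lambda>z. f z * g z)"
    and class_lim: "(\<And>n. circle_bounded (s n)) \<Longrightarrow> (\<And>n::nat. P (s n)) \<Longrightarrow> circle_bounded f \<Longrightarrow>
      (\<And>n z. cmod z = 1 \<Longrightarrow> cmod (s n z) \<le> B) \<Longrightarrow>
      (\<And>z. cmod z = 1 \<Longrightarrow> (\<lambda>n. s n z) \<longlonglongrightarrow> f z) \<Longrightarrow> P f"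
begin

text \<open>The constant sequence \<open>f\<close> converges to \<open>g\<close> on the circle, so
  values off the circle do not matter.\<close>

lemma cong:
  assumes "circle_bounded f" "P f" "circle_bounded g" "\<And>z. cmod z = 1 \<Longrightarrow> f z = g z"
  shows "P g"
proof -
  obtain B where "\<And>z. cmod z = 1 \<Longrightarrow> cmod (f z) \<le> B"
    using assms(1) by (metis circle_boundedE)
  then show ?thesis
    using assms by (intro class_lim[of "\<lambda>_. f" g B]) auto
qed

lemma real_polynomial:
  assumes "real_polynomial_function p"
  shows "P (\<lambda>z. complex_of_real (p z))"
  using assms
proof induction
  case (linear f)
  \<comment> \<open>Since \<open>b\<close> is the conjugate of \<open>a\<close>,
    \<open>a * z + b * cnj z\<close> is twice the real part of \<open>a * z\<close>, which is
    \<open>f\<close> expanded in the real basis 1, \<open>\<i>\<close>.\<close>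
  define a where "a = Complex (f 1 / 2) (- f \<i> / 2)"
  define b where "b = Complex (f 1 / 2) (f \<i> / 2)"
  have eq: "f z = Re z * f 1 + Im z * f \<i>" for z
  proof -
    have "f z = f (Re z *\<^sub>R 1 + Im z *\<^sub>R \<i>)"
      by (rule arg_cong[of _ _ f]) (simp add: complex_eq_iff)
    then show ?thesis
      using linear by (simp add: linear_simps)
  qed
  have "complex_of_real (f z) = a * z + b * cnj z" for z
    unfolding a_def b_def by (subst eq) (simp add: complex_eq_iff)
  moreover have "P (\<lambda>z. a * z + b * cnj z)"
    by (intro class_add class_mult class_const class_id class_cnj circle_bounded_mult circle_bounded_const circle_bounded_id circle_bounded_cnj)
  ultimately show ?case by simp
next
  case (const c)
  then show ?case by (intro class_const)
next
  case (add f g)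
  have "circle_bounded (\<lambda>z. complex_of_real (f z))" "circle_bounded (\<lambda>z. complex_of_real (g z))"
    using add.hyps by (simp_all add: circle_bounded_real_polynomial)
  from class_add[OF this add.IH] show ?case by simp
next
  case (mult f g)
  have "circle_bounded (\<lambda>z. complex_of_real (f z))" "circle_bounded (\<lambda>z. complex_of_real (g z))"
    using mult.hyps by (simp_all add: circle_bounded_real_polynomial)
  from class_mult[OF this mult.IH] show ?case by simp
qed

text \<open>Uniform approximation by polynomials on the compact circle meets both demands of
  \<open>class_lim\<close>: the pointwise limit, and the common bound \<open>B + 1\<close>, as every
  error is below 1.\<close>

lemma continuous:
  fixes f :: "complex \<Rightarrow> real"
  assumes f: "continuous_on UNIV f"
  shows "P (\<lambda>z. complex_of_real (f z))"
proof -
  have "\<exists>p. real_polynomial_function p \<and> (\<forall>z. cmod z = 1 \<longrightarrow> \<bar>f z - p z\<bar> < 1 / Suc n)" for n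
  proof (rule Stone_Weierstrass_real_polynomial_function[of "sphere 0 1" f "1 / Suc n"])
    show "continuous_on (sphere 0 1) f" using f by (rule continuous_on_subset) simp
  qed auto
  then obtain p where p: "\<And>n. real_polynomial_function (p n)"
      "\<And>n z. cmod z = 1 \<Longrightarrow> \<bar>f z - p n z\<bar> < 1 / Suc n"
    by metis
  have bf: "circle_bounded (\<lambda>z. complex_of_real (f z))"
    using f by (auto intro!: circle_bounded_continuous continuous_intros)
  then obtain B where B: "\<And>z. cmod z = 1 \<Longrightarrow> cmod (complex_of_real (f z)) \<le> B"
    by (metis circle_boundedE)
  show ?thesis
  proof (rule class_lim[of "\<lambda>n z. complex_of_real (p n z)" _ "B + 1"])
    show "circle_bounded (\<lambda>z. complex_of_real (p n z))" for n
      by (rule circle_bounded_real_polynomial[OF p(1)])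
    show "P (\<lambda>z. complex_of_real (p n z))" for n
      by (rule real_polynomial[OF p(1)])
    show "circle_bounded (\<lambda>z. complex_of_real (f z))" by (rule bf)
    show "cmod (complex_of_real (p n z)) \<le> B + 1" if "cmod z = 1" for n z
    proof -
      have "1 / real (Suc n) \<le> 1" by simp
      then have "\<bar>f z - p n z\<bar> < 1" using p(2)[OF that, of n] by linarith
      then show ?thesis using B[OF that] by simp
    qed
    show "(\<lambda>n. complex_of_real (p n z)) \<longlonglongrightarrow> complex_of_real (f z)" if "cmod z = 1" for z
    proof (intro tendsto_of_real)
      have "(\<lambda>n. f z - p n z) \<longlonglongrightarrow> 0"
        by (rule Lim_null_comparison[OF _ LIMSEQ_inverse_real_of_nat])
          (use p(2)[OF that] in \<open>auto intro!: always_eventually less_imp_le simp: inverse_eq_divide\<close>)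
      then show "(\<lambda>n. p n z) \<longlonglongrightarrow> f z"
        using tendsto_diff[OF tendsto_const[of "f z"]] by fastforce
    qed
  qed
qed

text \<open>The indicator is the pointwise limit of \<open>max 0 (1 - n * infdist z C)\<close>: at a
  point outside \<open>C\<close> the distance is positive, so the terms vanish for large
  \<open>n\<close>.\<close>

lemma indicator_closed:
  assumes "closed C"
  shows "P (indicator C)"
\<comment> \<open>\<open>infdist\<close> to the empty set is 0 by convention, so the approximants
  would be constantly 1 there.\<close>
proof (cases "C = {}")
  case True
  then show ?thesis using class_const[of 0] by (simp add: indicator_def[abs_def])
next
  case False
  define s where "s n z = max 0 (1 - real n * infdist z C)" for n z
  have cs: "continuous_on UNIV (s n)" for n
    unfolding s_def by (intro continuous_intros)
  show ?thesis
  proof (rule class_lim[of "\<lambda>n z. complex_of_real (s n z)" _ 1])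
    show "P (\<lambda>z. complex_of_real (s n z))" for n
      by (rule continuous[OF cs])
    show "circle_bounded (\<lambda>z. complex_of_real (s n z))" for n
      using cs by (auto intro!: circle_bounded_continuous continuous_intros)
    show "circle_bounded (indicator C)"
      using assms by (intro circle_bounded_indicator) auto
    show "cmod (complex_of_real (s n z)) \<le> 1" for n z
      by (auto simp: s_def infdist_nonneg)
    show "(\<lambda>n. complex_of_real (s n z)) \<longlonglongrightarrow> indicator C z" for z
    proof (cases "z \<in> C")
      case True
      then show ?thesis by (simp add: s_def)
    next
      case False
      then have pos: "infdist z C > 0"
        using assms \<open>C \<noteq> {}\<close> by (metis in_closed_iff_infdist_zero infdist_nonneg less_eq_real_def)
      obtain N :: nat where N: "1 < real N * infdist z C"
        using ex_less_of_nat_mult[OF pos] by blast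
      have "s n z = 0" if "n \<ge> N" for n
      proof -
        have "real N * infdist z C \<le> real n * infdist z C"
          using that pos by (intro mult_right_mono) auto
        then show ?thesis using N by (simp add: s_def)
      qed
      then have "\<forall>\<^sub>F n in sequentially. complex_of_real (s n z) = 0"
        unfolding eventually_sequentially by auto
      then show ?thesis using False by (simp add: tendsto_eventually)
    qed
  qed
qed

lemma sum:
  assumes "finite I" "\<And>i. i \<in> I \<Longrightarrow> circle_bounded (f i) \<and> P (f i)"
  shows "circle_bounded (\<lambda>z. \<Sum>i\<in>I. f i z) \<and> P (\<lambda>z. \<Sum>i\<in>I. f i z)"
  using assms
  by (induction I) (auto intro!: class_add circle_bounded_add intro: class_const circle_bounded_const)

text \<open>Dynkin's argument from the intersection-stable generator of closed sets. Disjointness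
  keeps the partial sums of indicators below 1, as \<open>class_lim\<close> requires.\<close>

lemma indicator_borel:
  assumes "B \<in> sets borel"
  shows "P (indicator B)"
proof -
  have stable: "Int_stable (Collect closed :: complex set set)"
    by (auto simp: Int_stable_def)
  have B: "B \<in> sigma_sets UNIV (Collect closed)"
    using assms by (subst (asm) borel_eq_closed) simp
  have "Collect closed \<subseteq> Pow (UNIV :: complex set)" by simp
  with stable show ?thesis
    using B
  proof (induction rule: sigma_sets_induct_disjoint)
    case (basic A)
    then show ?case by (simp add: indicator_closed)
  next
    case empty
    then show ?case using class_const[of 0] by (simp add: indicator_def[abs_def])
  next
    case (compl A)
    then have "A \<in> sets borel" by (subst borel_eq_closed) simp
    note cA = circle_bounded_indicator[OF this]
    have "P (\<lambda>z. 1 + (- 1) * indicator A z)"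
      by (intro class_add class_mult class_const cA circle_bounded_mult circle_bounded_const compl)
    moreover have "(\<lambda>z. 1 + (- 1) * indicator A z) = (indicator (UNIV - A) :: complex \<Rightarrow> complex)"
      by (auto simp: fun_eq_iff indicator_def)
    ultimately show ?case by simp
  next
    case (union A)
    then have A: "A i \<in> sets borel" for i by (subst borel_eq_closed) auto
    have eq: "(\<Sum>i<n. indicator (A i) z) = (indicator (\<Union>i<n. A i) z :: complex)" for n z
      using union(1) by (subst indicator_UN_disjoint)
        (auto simp: disjoint_family_on_def)
    show ?case
    proof (rule class_lim[of "\<lambda>n z. \<Sum>i<n. indicator (A i) z" _ 1])
      show "circle_bounded (\<lambda>z. \<Sum>i<n. indicator (A i) z)" for n
        using sum[of "{..<n}" "\<lambda>i. indicator (A i)"] A union by (auto intro: circle_bounded_indicator)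
      show "P (\<lambda>z. \<Sum>i<n. indicator (A i) z)" for n
        using sum[of "{..<n}" "\<lambda>i. indicator (A i)"] A union by (auto intro: circle_bounded_indicator)
      show "circle_bounded (indicator (\<Union> (range A)))"
        using A by (intro circle_bounded_indicator) auto
      show "cmod (\<Sum>i<n. indicator (A i) z) \<le> 1" for n z
        unfolding eq by (simp add: indicator_def)
      show "(\<lambda>n. \<Sum>i<n. indicator (A i) z) \<longlonglongrightarrow> (indicator (\<Union> (range A)) z :: complex)" for z
        unfolding eq by (rule LIMSEQ_indicator_UN)
    qed
  qed
qed

text \<open>Simple functions dominated by \<open>2 * cmod (f z)\<close> converge to
  \<open>f\<close>, and each is, on the circle, a finite combination of Borel indicators.\<close>

theorem bounded_measurable:
  assumes f: "circle_bounded f"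
  shows "P f"
proof -
  obtain s where s: "\<And>i. simple_function circle (s i)"
      "\<forall>x\<in>space circle. (\<lambda>i. s i x) \<longlonglongrightarrow> f x"
      "\<forall>i. \<forall>x\<in>space circle. dist (s i x) 0 \<le> 2 * dist (f x) 0"
    using borel_measurable_implies_sequence_metric[OF circle_bounded_measurable[OF f], of 0]
    by metis
  obtain B where B: "\<And>z. cmod z = 1 \<Longrightarrow> cmod (f z) \<le> B"
    using f by (metis circle_boundedE)
  have Bs: "cmod (s n z) \<le> 2 * B" if "cmod z = 1" for n z
  proof -
    have "cmod (s n z) \<le> 2 * cmod (f z)" using s(3) that by simp
    then show ?thesis using B[OF that] by simp
  qed
  have bs: "circle_bounded (s n)" for n
    using s(1) Bs by (intro circle_boundedI borel_measurable_simple_function) auto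
  have "P (s n)" for n
  proof -
    let ?I = "s n ` space circle" and ?A = "\<lambda>y. s n -` {y} \<inter> space circle"
    have fin: "finite ?I" using s(1)[of n] by (auto simp: simple_function_def)
    have A: "?A y \<in> sets borel" for y
      using simple_functionD(2)[OF s(1)[of n], of "{y}"] by (simp add: sets_circle_eq)
    have "circle_bounded (\<lambda>z. \<Sum>y\<in>?I. y * indicator (?A y) z) \<and> P (\<lambda>z. \<Sum>y\<in>?I. y * indicator (?A y) z)"
    proof (rule sum[OF fin])
      fix y
      note c = circle_bounded_const[of y] circle_bounded_indicator[OF A[of y]]
      show "circle_bounded (\<lambda>z. y * indicator (?A y) z) \<and> P (\<lambda>z. y * indicator (?A y) z)"
        using circle_bounded_mult[OF c] class_mult[OF c class_const indicator_borel[OF A]] by simp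
    qed
    \<comment> \<open>Off the circle the sum is 0 while \<open>s n\<close> is arbitrary, so equality
      is claimed on the circle only and \<open>cong\<close> finishes.\<close>
    moreover have "(\<Sum>y\<in>?I. y * indicator (?A y) z) = s n z" if "cmod z = 1" for z
    proof -
      have "(\<Sum>y\<in>?I. y * indicator (?A y) z) = (\<Sum>y\<in>{s n z}. y * indicator (?A y) z)"
        using that fin by (intro sum.mono_neutral_right) (auto simp: indicator_def)
      then show ?thesis using that by simp
    qed
    ultimately show ?thesis using cong bs by blast
  qed
  then show ?thesis
    using s(2) by (intro class_lim[OF bs _ f Bs]) auto
qed

end


section \<open>Multiplication operators\<close>

lemma l2_circle_cases:
  obtains f where "square_integrable f" "x = abs_l2_circle f"
proof
  show "square_integrable (rep_l2_circle x)"
    using Quotient3_rep_reflp[OF Quotient3_l2_circle, of x] by (simp add: l2_rel_def)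
  show "x = abs_l2_circle (rep_l2_circle x)"
    using Quotient3_abs_rep[OF Quotient3_l2_circle, of x] by simp
qed

lemma abs_l2_circle_eq_iff:
  assumes "square_integrable f" "square_integrable g"
  shows "abs_l2_circle f = abs_l2_circle g \<longleftrightarrow> (AE z in circle. f z = g z)"
  using Quotient3_rel[OF Quotient3_l2_circle, of f g] assms by (auto simp: l2_rel_def)

lemma abs_l2_circle_cong:
  assumes "square_integrable f" "square_integrable g" "\<And>z. cmod z = 1 \<Longrightarrow> f z = g z"
  shows "abs_l2_circle f = abs_l2_circle g"
  using assms by (subst abs_l2_circle_eq_iff) (auto intro!: AE_I2)

lemma abs_l2_circle_add:
  "square_integrable f \<Longrightarrow> square_integrable g \<Longrightarrow>
    abs_l2_circle f + abs_l2_circle g = abs_l2_circle (\<lambda>z. f z + g z)"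
  by (simp add: plus_l2_circle.abs_eq l2_rel_def)

lemma abs_l2_circle_diff:
  "square_integrable f \<Longrightarrow> square_integrable g \<Longrightarrow>
    abs_l2_circle f - abs_l2_circle g = abs_l2_circle (\<lambda>z. f z - g z)"
  by (simp add: minus_l2_circle.abs_eq l2_rel_def)

lemma scaleC_abs_l2_circle:
  "square_integrable f \<Longrightarrow> scaleC c (abs_l2_circle f) = abs_l2_circle (\<lambda>z. c * f z)"
  by (simp add: scaleC.abs_eq l2_rel_def)

lemma square_integrable_circle_bounded_mult:
  "circle_bounded g \<Longrightarrow> square_integrable f \<Longrightarrow> square_integrable (\<lambda>z. g z * f z)"
  by (rule square_integrable_mult_bounded) (simp_all add: circle_bounded_def)

text \<open>Holds because the circle has finite total measure. The class of this constant is the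
  vector on which an operator in the commutant reveals its symbol.\<close>

lemma square_integrable_one: "square_integrable (\<lambda>_. 1)"
  using finite_measure.integrable_const[OF finite_measure_circle, of "1::real"]
  by (simp add: square_integrable_def)

lemma square_integrable_circle_bounded: "circle_bounded g \<Longrightarrow> square_integrable g"
  using square_integrable_circle_bounded_mult[OF _ square_integrable_one] by simp

lemma mult_l2_abs_l2_circle:
  "circle_bounded g \<Longrightarrow> square_integrable f \<Longrightarrow>
    mult_l2 g (abs_l2_circle f) = abs_l2_circle (\<lambda>z. g z * f z)"
  by (rule mult_l2_abs) (simp_all add: circle_bounded_def)

lemma mult_l2_one:
  "circle_bounded g \<Longrightarrow> mult_l2 g (abs_l2_circle (\<lambda>_. 1)) = abs_l2_circle g"
  by (simp add: mult_l2_abs_l2_circle square_integrable_one)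

lemma mult_l2_add:
  assumes "circle_bounded f" "circle_bounded g"
  shows "mult_l2 (\<lambda>z. f z + g z) x = mult_l2 f x + mult_l2 g x"
  by (rule l2_circle_cases[of x])
    (simp add: assms mult_l2_abs_l2_circle circle_bounded_add abs_l2_circle_add
      square_integrable_circle_bounded_mult distrib_right)

lemma mult_l2_mult:
  assumes "circle_bounded f" "circle_bounded g"
  shows "mult_l2 (\<lambda>z. f z * g z) x = mult_l2 f (mult_l2 g x)"
  by (rule l2_circle_cases[of x])
    (simp add: assms mult_l2_abs_l2_circle circle_bounded_mult
      square_integrable_circle_bounded_mult mult.assoc)

lemma mult_l2_commute:
  assumes "circle_bounded f" "circle_bounded g"
  shows "mult_l2 f (mult_l2 g x) = mult_l2 g (mult_l2 f x)"
  using assms by (simp add: mult_l2_mult[symmetric] mult.commute)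

lemma mult_l2_const: "mult_l2 (\<lambda>_. c) x = scaleC c x"
  by (rule l2_circle_cases[of x])
    (simp add: mult_l2_abs_l2_circle circle_bounded_const scaleC_abs_l2_circle)

lemma mult_l2_cong:
  assumes "circle_bounded f" "circle_bounded g" "\<And>z. cmod z = 1 \<Longrightarrow> f z = g z"
  shows "mult_l2 f x = mult_l2 g x"
  by (rule l2_circle_cases[of x])
    (use assms in \<open>auto simp: mult_l2_abs_l2_circle square_integrable_circle_bounded_mult
      intro!: abs_l2_circle_cong\<close>)

lemma scaleC_one: "scaleC 1 x = x"
  by (rule l2_circle_cases[of x]) (simp add: scaleC_abs_l2_circle)

text \<open>\<open>z * cnj z = 1\<close> on the circle. Multiplication by \<open>cnj\<close> thus
  inverts the shift, so commuting with the shift will entail commuting with its inverse.\<close>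

lemma mult_l2_id_cnj: "mult_l2 (\<lambda>z. z) (mult_l2 cnj x) = x"
proof -
  have "mult_l2 (\<lambda>z. z) (mult_l2 cnj x) = mult_l2 (\<lambda>z. z * cnj z) x"
    by (simp add: mult_l2_mult circle_bounded_id circle_bounded_cnj)
  also have "\<dots> = mult_l2 (\<lambda>_. 1) x"
    by (intro mult_l2_cong circle_bounded_mult circle_bounded_id circle_bounded_cnj circle_bounded_const)
      (simp add: complex_norm_square[symmetric])
  finally show ?thesis by (simp add: mult_l2_const scaleC_one)
qed

lemma mult_l2_bounded_operators:
  assumes g: "circle_bounded g"
  shows "mult_l2 g \<in> bounded_operators"
proof -
  obtain B where B: "\<And>z. cmod z = 1 \<Longrightarrow> cmod (g z) \<le> B" "B > 0"
    using g by (metis circle_boundedE)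
  have C: "mult_l2 g (scaleC c x) = scaleC c (mult_l2 g x)" for c x
    using mult_l2_commute[OF g circle_bounded_const] by (simp add: mult_l2_const)
  have "bounded_linear (mult_l2 g)"
  proof (rule bounded_linear_intro)
    fix x y :: l2_circle and r :: real
    obtain f h where f: "square_integrable f" "x = abs_l2_circle f"
      and h: "square_integrable h" "y = abs_l2_circle h"
      using l2_circle_cases by metis
    show "mult_l2 g (x + y) = mult_l2 g x + mult_l2 g y"
      using g f h by (simp add: abs_l2_circle_add mult_l2_abs_l2_circle square_integrable_add
          square_integrable_circle_bounded_mult distrib_left)
    show "mult_l2 g (r *\<^sub>R x) = r *\<^sub>R mult_l2 g x"
      by (simp add: scaleR_l2_circle_def C)
    have sq: "square_integrable (\<lambda>z. g z * f z)"
      using g f by (simp add: square_integrable_circle_bounded_mult)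
    have "(LINT z|circle. (cmod (g z * f z))\<^sup>2) \<le> (LINT z|circle. B\<^sup>2 * (cmod (f z))\<^sup>2)"
    proof (rule integral_mono)
      show "integrable circle (\<lambda>z. (cmod (g z * f z))\<^sup>2)" "integrable circle (\<lambda>z. B\<^sup>2 * (cmod (f z))\<^sup>2)"
        using sq f(1) by (simp_all add: square_integrable_def)
      show "(cmod (g z * f z))\<^sup>2 \<le> B\<^sup>2 * (cmod (f z))\<^sup>2" if "z \<in> space circle" for z
        using B that by (simp add: norm_mult power_mult_distrib mult_right_mono power_mono)
    qed
    then have "sqrt (LINT z|circle. (cmod (g z * f z))\<^sup>2) \<le> sqrt (B\<^sup>2 * (LINT z|circle. (cmod (f z))\<^sup>2))"
      by simp
    then show "norm (mult_l2 g x) \<le> norm x * B"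
      using B(2) g f sq by (simp add: mult_l2_abs_l2_circle norm_abs_l2_circle real_sqrt_mult mult.commute)
  qed
  then show ?thesis using C by (simp add: bounded_operators_def)
qed

lemma bounded_linear_mult_l2: "circle_bounded g \<Longrightarrow> bounded_linear (mult_l2 g)"
  using mult_l2_bounded_operators by (simp add: bounded_operators_def)

section \<open>Dominated convergence in L2\<close>

text \<open>The limit inherits the bound \<open>cmod (w z)\<close>, so the squared differences are
  dominated by four times its square and the scalar theorem applies.\<close>

lemma l2_circle_dominated_convergence:
  assumes s: "\<And>n. square_integrable (s n)" and f: "square_integrable f" and w: "square_integrable w"
    and bound: "\<And>n z. cmod z = 1 \<Longrightarrow> cmod (s n z) \<le> cmod (w z)"
    and lim: "\<And>z. cmod z = 1 \<Longrightarrow> (\<lambda>n. s n z) \<longlonglongrightarrow> f z"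
  shows "(\<lambda>n. abs_l2_circle (s n)) \<longlonglongrightarrow> abs_l2_circle f"
proof -
  have sq: "square_integrable (\<lambda>z. s n z - f z)" for n
    by (rule square_integrable_diff[OF s f])
  have fw: "cmod (f z) \<le> cmod (w z)" if "cmod z = 1" for z
    using tendsto_norm[OF lim[OF that]] bound[OF that] by (intro LIMSEQ_le_const2) auto
  have "(\<lambda>n. LINT z|circle. (cmod (s n z - f z))\<^sup>2) \<longlonglongrightarrow> (LINT z|circle. 0)"
  proof (rule integral_dominated_convergence)
    show "(\<lambda>z. (cmod (s n z - f z))\<^sup>2) \<in> borel_measurable circle" for n
      using sq by (auto simp: square_integrable_def)
    show "integrable circle (\<lambda>z. 4 * (cmod (w z))\<^sup>2)"
      using w by (simp add: square_integrable_def)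
    show "AE z in circle. (\<lambda>n. (cmod (s n z - f z))\<^sup>2) \<longlonglongrightarrow> 0"
    proof (rule AE_I2)
      fix z assume "z \<in> space circle"
      then have "(\<lambda>n. s n z) \<longlonglongrightarrow> f z" by (simp add: lim)
      then have "(\<lambda>n. (cmod (s n z - f z))\<^sup>2) \<longlonglongrightarrow> (cmod (f z - f z))\<^sup>2"
        by (intro tendsto_intros)
      then show "(\<lambda>n. (cmod (s n z - f z))\<^sup>2) \<longlonglongrightarrow> 0" by simp
    qed
    show "AE z in circle. norm ((cmod (s n z - f z))\<^sup>2) \<le> 4 * (cmod (w z))\<^sup>2" for n
    proof (rule AE_I2)
      fix z assume "z \<in> space circle"
      then have "cmod (s n z - f z) \<le> 2 * cmod (w z)"
        using norm_triangle_ineq4[of "s n z" "f z"] bound[of z n] fw[of z] by simp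
      then have "(cmod (s n z - f z))\<^sup>2 \<le> (2 * cmod (w z))\<^sup>2"
        by (intro power_mono) auto
      then show "norm ((cmod (s n z - f z))\<^sup>2) \<le> 4 * (cmod (w z))\<^sup>2"
        by (simp add: power_mult_distrib)
    qed
  qed simp
  then have "(\<lambda>n. sqrt (LINT z|circle. (cmod (s n z - f z))\<^sup>2)) \<longlonglongrightarrow> 0"
    using tendsto_real_sqrt by fastforce
  then have "(\<lambda>n. norm (abs_l2_circle (s n) - abs_l2_circle f)) \<longlonglongrightarrow> 0"
    by (simp add: abs_l2_circle_diff s f norm_abs_l2_circle sq)
  then show ?thesis
    by (rule LIM_zero_cancel[OF tendsto_norm_zero_cancel])
qed

text \<open>Bounded pointwise convergence of symbols gives strong convergence of the operators, with
  \<open>B * cmod (u z)\<close> dominating. This provides \<open>class_lim\<close> in both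
  interpretations.\<close>

lemma mult_l2_tendsto:
  assumes s: "\<And>n. circle_bounded (s n)" and f: "circle_bounded f"
    and bound: "\<And>n z. cmod z = 1 \<Longrightarrow> cmod (s n z) \<le> B"
    and lim: "\<And>z. cmod z = 1 \<Longrightarrow> (\<lambda>n. s n z) \<longlonglongrightarrow> f z"
  shows "(\<lambda>n. mult_l2 (s n) x) \<longlonglongrightarrow> mult_l2 f x"
proof -
  obtain u where u: "square_integrable u" "x = abs_l2_circle u"
    by (rule l2_circle_cases)
  have "B \<ge> 0" using order_trans[OF norm_ge_zero bound[of 1 0]] by simp
  have "(\<lambda>n. abs_l2_circle (\<lambda>z. s n z * u z)) \<longlonglongrightarrow> abs_l2_circle (\<lambda>z. f z * u z)"
  proof (rule l2_circle_dominated_convergence)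
    show "square_integrable (\<lambda>z. s n z * u z)" for n
      by (rule square_integrable_circle_bounded_mult[OF s u(1)])
    show "square_integrable (\<lambda>z. f z * u z)"
      by (rule square_integrable_circle_bounded_mult[OF f u(1)])
    show "square_integrable (\<lambda>z. complex_of_real B * u z)"
      by (rule square_integrable_cmult[OF u(1)])
    show "cmod (s n z * u z) \<le> cmod (complex_of_real B * u z)" if "cmod z = 1" for n z
      using bound[OF that, of n] \<open>B \<ge> 0\<close> by (simp add: norm_mult mult_right_mono)
    show "(\<lambda>n. s n z * u z) \<longlonglongrightarrow> f z * u z" if "cmod z = 1" for z
      by (intro tendsto_intros lim that)
  qed
  then show ?thesis using s f u by (simp add: mult_l2_abs_l2_circle)
qed

section \<open>Separability\<close>

text \<open>Polynomials in \<open>z\<close> and its conjugate with coefficients in Q + iQ, kept as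
  syntax trees so that countability comes with the datatype.\<close>

datatype circle_poly = Coeff rat rat | Var | Conj
  | Add circle_poly circle_poly | Mult circle_poly circle_poly

instance circle_poly :: countable
  by countable_datatype

primrec poly_fun :: "circle_poly \<Rightarrow> complex \<Rightarrow> complex" where
  "poly_fun (Coeff p q) = (\<lambda>_. Complex (of_rat p) (of_rat q))"
| "poly_fun Var = (\<lambda>z. z)"
| "poly_fun Conj = cnj"
| "poly_fun (Add s t) = (\<lambda>z. poly_fun s z + poly_fun t z)"
| "poly_fun (Mult s t) = (\<lambda>z. poly_fun s z * poly_fun t z)"

lemma circle_bounded_poly_fun: "circle_bounded (poly_fun t)"
  by (induction t) (auto intro: circle_bounded_const circle_bounded_id circle_bounded_cnj
      circle_bounded_add circle_bounded_mult)

lemma complex_rational_sequence: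
  obtains p q :: "nat \<Rightarrow> rat" where "(\<lambda>n. Complex (of_rat (p n)) (of_rat (q n))) \<longlonglongrightarrow> c"
proof -
  have *: "\<exists>p :: nat \<Rightarrow> rat. (\<lambda>n. real_of_rat (p n)) \<longlonglongrightarrow> x" for x :: real
  proof -
    have "\<exists>r. x < real_of_rat r \<and> real_of_rat r < x + inverse (real (Suc n))" for n
      by (rule of_rat_dense) simp
    then obtain p where p: "\<And>n. x < real_of_rat (p n)"
        "\<And>n. real_of_rat (p n) < x + inverse (real (Suc n))"
      by metis
    have "(\<lambda>n. real_of_rat (p n)) \<longlonglongrightarrow> x"
      by (rule tendsto_sandwich[OF _ _ tendsto_const LIMSEQ_inverse_real_of_nat_add])
        (use p in \<open>auto intro!: always_eventually less_imp_le simp del: of_nat_Suc\<close>)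
    then show ?thesis by blast
  qed
  obtain p q :: "nat \<Rightarrow> rat" where "(\<lambda>n. real_of_rat (p n)) \<longlonglongrightarrow> Re c" "(\<lambda>n. real_of_rat (q n)) \<longlonglongrightarrow> Im c"
    using * by metis
  then have "(\<lambda>n. Complex (of_rat (p n)) (of_rat (q n))) \<longlonglongrightarrow> Complex (Re c) (Im c)"
    by (intro tendsto_Complex)
  then show ?thesis using that by simp
qed

text \<open>Symbols whose multiplication maps the closure of the polynomials into itself form a
  \<open>circle_function_class\<close>, hence include every bounded measurable function.\<close>

lemma mult_l2_closure_poly_fun:
  assumes "circle_bounded g" "x \<in> closure (range (\<lambda>t. abs_l2_circle (poly_fun t)))"
  shows "mult_l2 g x \<in> closure (range (\<lambda>t. abs_l2_circle (poly_fun t)))"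
proof -
  let ?R = "range (\<lambda>t. abs_l2_circle (poly_fun t))"
  have poly: "mult_l2 (poly_fun s) x \<in> closure ?R" if "x \<in> closure ?R" for s x
  proof -
    \<comment> \<open>A bounded operator carries a closure into the closure of the image, and
      \<open>Mult\<close> keeps the image inside the polynomials.\<close>
    have "mult_l2 (poly_fun s) ` closure ?R \<subseteq> closure (mult_l2 (poly_fun s) ` ?R)"
      by (intro closure_bounded_linear_image_subset bounded_linear_mult_l2 circle_bounded_poly_fun)
    moreover have "mult_l2 (poly_fun s) (abs_l2_circle (poly_fun t)) = abs_l2_circle (poly_fun (Mult s t))" for t
      by (simp add: mult_l2_abs_l2_circle circle_bounded_poly_fun square_integrable_circle_bounded)
    then have "mult_l2 (poly_fun s) ` ?R \<subseteq> ?R" by blast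
    ultimately show ?thesis using that closure_mono by blast
  qed
  have plus: "x + y \<in> closure ?R" if xy: "x \<in> closure ?R" "y \<in> closure ?R" for x y
  proof -
    obtain s t where st: "\<And>n. s n \<in> ?R" "s \<longlonglongrightarrow> x" "\<And>n. t n \<in> ?R" "t \<longlonglongrightarrow> y"
      using xy unfolding closure_sequential by blast
    have "abs_l2_circle (poly_fun a) + abs_l2_circle (poly_fun b) = abs_l2_circle (poly_fun (Add a b))" for a b
      by (simp add: abs_l2_circle_add circle_bounded_poly_fun square_integrable_circle_bounded)
    then have "s n + t n \<in> ?R" for n
      using st(1,3)[of n] by (smt (verit) imageE rangeI)
    moreover have "(\<lambda>n. s n + t n) \<longlonglongrightarrow> x + y"
      by (intro tendsto_add st)
    ultimately show ?thesis unfolding closure_sequential by (intro exI[of _ "\<lambda>n. s n + t n"]) simp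
  qed
  have lim: "mult_l2 f x \<in> closure ?R"
    if "\<And>n. circle_bounded (s n)" "\<And>n::nat. mult_l2 (s n) x \<in> closure ?R" "circle_bounded f"
      "\<And>n z. cmod z = 1 \<Longrightarrow> cmod (s n z) \<le> B"
      "\<And>z. cmod z = 1 \<Longrightarrow> (\<lambda>n. s n z) \<longlonglongrightarrow> f z" for s f B x
  proof -
    have "(\<lambda>n. mult_l2 (s n) x) \<longlonglongrightarrow> mult_l2 f x"
      by (rule mult_l2_tendsto[of s f B]) (fact that)+
    with that(2) show ?thesis by (rule closed_sequentially[OF closed_closure])
  qed
  interpret circle_function_class "\<lambda>g. \<forall>x\<in>closure ?R. mult_l2 g x \<in> closure ?R"
  proof
    fix c
    \<comment> \<open>An arbitrary constant is a limit of constants from Q + iQ; a convergent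
      sequence is bounded, so \<open>lim\<close> applies.\<close>
    obtain p q :: "nat \<Rightarrow> rat" where pq: "(\<lambda>n. Complex (of_rat (p n)) (of_rat (q n))) \<longlonglongrightarrow> c"
      by (rule complex_rational_sequence)
    then have "bounded (range (\<lambda>n. Complex (of_rat (p n)) (of_rat (q n))))"
      by (rule convergent_imp_bounded)
    then obtain B where "\<And>n. cmod (Complex (of_rat (p n)) (of_rat (q n))) \<le> B"
      by (auto simp: bounded_iff)
    moreover have "mult_l2 (\<lambda>z. Complex (of_rat (p n)) (of_rat (q n))) x \<in> closure ?R"
      if "x \<in> closure ?R" for n x
      using poly[OF that, of "Coeff (p n) (q n)"] by simp
    ultimately show "\<forall>x\<in>closure ?R. mult_l2 (\<lambda>_. c) x \<in> closure ?R"
      using lim[of "\<lambda>n z. Complex (of_rat (p n)) (of_rat (q n))" _ "\<lambda>_. c" B] pq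
      by (simp add: circle_bounded_const)
  next
    show "\<forall>x\<in>closure ?R. mult_l2 (\<lambda>z. z) x \<in> closure ?R" using poly[of _ Var] by simp
    show "\<forall>x\<in>closure ?R. mult_l2 cnj x \<in> closure ?R" using poly[of _ Conj] by simp
  next
    fix s :: "nat \<Rightarrow> complex \<Rightarrow> complex" and f B
    assume "\<And>n. circle_bounded (s n)" "\<And>n. \<forall>x\<in>closure ?R. mult_l2 (s n) x \<in> closure ?R"
      "circle_bounded f" "\<And>n z. cmod z = 1 \<Longrightarrow> cmod (s n z) \<le> B"
      "\<And>z. cmod z = 1 \<Longrightarrow> (\<lambda>n. s n z) \<longlonglongrightarrow> f z"
    then show "\<forall>x\<in>closure ?R. mult_l2 f x \<in> closure ?R"
      by (intro ballI lim[of s _ f B]) auto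
  qed (simp_all add: mult_l2_add mult_l2_mult plus)
  show ?thesis using bounded_measurable[OF assms(1)] assms(2) by blast
qed

text \<open>A bounded function is its own multiplication operator applied to the polynomial 1, so it
  lies in the closure of the polynomials; truncations then reach all of L2.\<close>

lemma l2_circle_dense_sequence:
  obtains e :: "nat \<Rightarrow> complex \<Rightarrow> complex"
  where "\<And>k. circle_bounded (e k)" "closure (range (\<lambda>k. abs_l2_circle (e k))) = UNIV"
proof -
  let ?V = "closure (range (\<lambda>t. abs_l2_circle (poly_fun t)))"
  have "x \<in> ?V" for x
  proof -
    obtain f where f: "square_integrable f" "x = abs_l2_circle f"
      by (rule l2_circle_cases)
    \<comment> \<open>Cutting off to 0 where \<open>f\<close> is large keeps
      \<open>cmod (s n z) \<le> cmod (f z)\<close>, so \<open>f\<close> itself dominates.\<close>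
    define s where "s n z = (if cmod (f z) \<le> real n then f z else 0)" for n :: nat and z
    note [measurable] = square_integrable_measurable[OF f(1)]
    have "s n \<in> borel_measurable circle" for n
      unfolding s_def by measurable
    then have s: "circle_bounded (s n)" for n
      by (rule circle_boundedI[where B = n]) (simp add: s_def)
    have "poly_fun (Coeff 1 0) = (\<lambda>_. 1)"
      by (simp add: complex_eq_iff fun_eq_iff)
    then have "abs_l2_circle (\<lambda>_. 1) \<in> ?V"
      by (metis closure_subset rangeI subsetD)
    then have "abs_l2_circle (s n) \<in> ?V" for n
      using mult_l2_closure_poly_fun[OF s] by (simp add: mult_l2_one[OF s, symmetric])
    moreover have "(\<lambda>n. abs_l2_circle (s n)) \<longlonglongrightarrow> abs_l2_circle f"
    proof (rule l2_circle_dominated_convergence)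
      show "square_integrable (s n)" for n using s by (rule square_integrable_circle_bounded)
      show "square_integrable f" "square_integrable f" by (rule f)+
      show "cmod (s n z) \<le> cmod (f z)" for n z by (simp add: s_def)
      show "(\<lambda>n. s n z) \<longlonglongrightarrow> f z" for z
      proof (rule tendsto_eventually)
        show "\<forall>\<^sub>F n in sequentially. s n z = f z"
          using eventually_ge_at_top[of "nat \<lceil>cmod (f z)\<rceil>"]
          by eventually_elim (auto simp: s_def)
      qed
    qed
    ultimately show ?thesis
      unfolding f(2) by (rule closed_sequentially[OF closed_closure])
  qed
  moreover have "range (\<lambda>k. abs_l2_circle (poly_fun (from_nat k))) = range (\<lambda>t. abs_l2_circle (poly_fun t))"
    using surj_from_nat[where 'a = circle_poly] by (metis image_image)
  ultimately show ?thesis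
    using that[of "\<lambda>k. poly_fun (from_nat k)"] circle_bounded_poly_fun by auto
qed


section \<open>Measurable selection of representatives\<close>

text \<open>Plain L2 convergence gives almost everywhere convergence only along a subsequence. Here
  the squared norms are summable, so the sum of the squared differences is finite almost everywhere
  and its terms tend to 0.\<close>

lemma AE_tendsto_of_norm_le_half_power:
  assumes f: "square_integrable f" and u: "\<And>n. square_integrable (u n)"
    and le: "\<And>n. norm (abs_l2_circle (u n) - abs_l2_circle f) \<le> (1/2) ^ n"
  shows "AE z in circle. (\<lambda>n. u n z) \<longlonglongrightarrow> f z"
proof -
  have sq: "square_integrable (\<lambda>z. u n z - f z)" for n
    by (rule square_integrable_diff[OF u f])
  then have int: "integrable circle (\<lambda>z. (cmod (u n z - f z))\<^sup>2)" for n
    by (simp add: square_integrable_def)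
  have [measurable]: "(\<lambda>z. (cmod (u n z - f z))\<^sup>2) \<in> borel_measurable circle" for n
    using int by (rule borel_measurable_integrable)
  have "(\<integral>\<^sup>+z. ennreal ((cmod (u n z - f z))\<^sup>2) \<partial>circle) \<le> ennreal ((1/4) ^ n)" for n
  proof -
    have "(LINT z|circle. (cmod (u n z - f z))\<^sup>2) = (norm (abs_l2_circle (u n) - abs_l2_circle f))\<^sup>2"
      by (simp add: abs_l2_circle_diff u f norm_abs_l2_circle sq)
    also have "\<dots> \<le> ((1/2) ^ n)\<^sup>2"
      by (intro power_mono le) simp
    also have "\<dots> = (1/4) ^ n"
      by (simp add: power_mult_distrib[symmetric] power2_eq_square)
    finally show ?thesis
      by (subst nn_integral_eq_integral[OF int]) (auto intro: ennreal_leI)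
  qed
  then have "(\<Sum>n. \<integral>\<^sup>+z. ennreal ((cmod (u n z - f z))\<^sup>2) \<partial>circle) \<le> (\<Sum>n. ennreal ((1/4) ^ n))"
    by (intro suminf_le summableI)
  also have "\<dots> = ennreal (\<Sum>n. (1/4) ^ n)"
    by (intro suminf_ennreal2 summable_geometric) auto
  also have "\<dots> < \<infinity>" by simp
  finally have "(\<integral>\<^sup>+z. (\<Sum>n. ennreal ((cmod (u n z - f z))\<^sup>2)) \<partial>circle) \<noteq> \<infinity>"
    by (simp add: nn_integral_suminf)
  then have "AE z in circle. (\<Sum>n. ennreal ((cmod (u n z - f z))\<^sup>2)) \<noteq> \<infinity>"
    by (intro nn_integral_PInf_AE) auto
  then show ?thesis
  proof eventually_elim
    case (elim z)
    then have "summable (\<lambda>n. (cmod (u n z - f z))\<^sup>2)"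
      by (intro summable_suminf_not_top) auto
    then have "(\<lambda>n. sqrt ((cmod (u n z - f z))\<^sup>2)) \<longlonglongrightarrow> sqrt 0"
      by (intro tendsto_real_sqrt summable_LIMSEQ_zero)
    then have "(\<lambda>n. norm (u n z - f z)) \<longlonglongrightarrow> 0" by simp
    then show ?case by (rule LIM_zero_cancel[OF tendsto_norm_zero_cancel])
  qed
qed

text \<open>By continuity the inequality extends to all \<open>y\<close>, and \<open>y = x\<close>
  gives the claim. It reduces a norm bound to countably many conditions on inner products when
  \<open>e\<close> is a sequence.\<close>

lemma norm_le_of_inner_le_dense:
  fixes x :: "'b :: real_inner"
  assumes "closure (range e) = UNIV" "\<And>k. inner x (e k) \<le> r * norm (e k)" "r \<ge> 0"
  shows "norm x \<le> r"
proof -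
  have "closed {y. inner x y \<le> r * norm y}"
    by (intro closed_Collect_le continuous_intros)
  then have "closure (range e) \<subseteq> {y. inner x y \<le> r * norm y}"
    using assms(2) by (intro closure_minimal) auto
  then have "inner x x \<le> r * norm x"
    using assms(1) by auto
  then have "norm x * norm x \<le> r * norm x"
    by (simp add: dot_square_norm power2_eq_square)
  then show ?thesis
    using assms(3) by (cases "x = 0") auto
qed

text \<open>
  The index of the approximating function is chosen by a criterion that involves only countably
  many inner products, so that weak measurability makes the choice measurable.
\<close>

lemma measurable_representative:
  assumes h: "\<And>y. (\<lambda>\<omega>. cinner (h \<omega>) y) \<in> borel_measurable M"
  obtains \<phi> where "\<phi> \<in> borel_measurable (M \<Otimes>\<^sub>M circle)"
    "\<And>\<omega>. \<omega> \<in> space M \<Longrightarrow> square_integrable (\<lambda>z. \<phi> (\<omega>, z))"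
    "\<And>\<omega>. \<omega> \<in> space M \<Longrightarrow> abs_l2_circle (\<lambda>z. \<phi> (\<omega>, z)) = h \<omega>"
proof -
  obtain e :: "nat \<Rightarrow> complex \<Rightarrow> complex" where e: "\<And>k. circle_bounded (e k)"
      and dense: "closure (range (\<lambda>k. abs_l2_circle (e k))) = UNIV"
    by (rule l2_circle_dense_sequence) blast
  define E where "E k = abs_l2_circle (e k)" for k
  have dense_E: "closure (range E) = UNIV"
    using dense by (simp add: E_def[abs_def])
  define Q where "Q n k \<omega> \<longleftrightarrow> (\<forall>j. inner (h \<omega> - E k) (E j) \<le> (1/2) ^ n * norm (E j))" for n k :: nat and \<omega>
  define K where "K n \<omega> = (LEAST k. Q n k \<omega>)" for n \<omega>
  have Q_le: "norm (h \<omega> - E k) \<le> (1/2) ^ n" if "Q n k \<omega>" for n k \<omega>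
    using that dense_E by (intro norm_le_of_inner_le_dense[of E]) (auto simp: Q_def)
  \<comment> \<open>Density provides a close \<open>E k\<close>, and Cauchy-Schwarz turns closeness
    in norm into the inner product conditions.\<close>
  have "\<exists>k. Q n k \<omega>" for n \<omega>
  proof -
    have "h \<omega> \<in> closure (range E)" by (simp add: dense_E)
    then obtain k where "dist (E k) (h \<omega>) < (1/2) ^ n"
      unfolding closure_approachable by (metis imageE zero_less_divide_1_iff zero_less_numeral zero_less_power)
    then have "norm (h \<omega> - E k) \<le> (1/2) ^ n"
      by (simp add: dist_norm norm_minus_commute)
    then have "inner (h \<omega> - E k) (E j) \<le> (1/2) ^ n * norm (E j)" for j
      using norm_cauchy_schwarz[of "h \<omega> - E k" "E j"] mult_right_mono[of _ _ "norm (E j)"]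
      by (meson norm_ge_zero order_trans)
    then show ?thesis unfolding Q_def by blast
  qed
  then have "Q n (K n \<omega>) \<omega>" for n \<omega>
    unfolding K_def by (rule LeastI_ex)
  then have K_le: "norm (h \<omega> - E (K n \<omega>)) \<le> (1/2) ^ n" for n \<omega>
    by (rule Q_le)
  \<comment> \<open>\<open>\<omega>\<close> enters only through
    \<open>cinner (h \<omega>) (E j)\<close>, which is measurable by assumption.\<close>
  have inner_eq: "inner (h \<omega> - E k) (E j) = Re (cinner (h \<omega>) (E j)) - inner (E k) (E j)" for \<omega> k j
    by (simp add: inner_diff_left) (simp add: inner_l2_circle_def)
  note [measurable] = h
  have [measurable]: "Measurable.pred M (Q n k)" for n k
    unfolding Q_def inner_eq by measurable
  have [measurable]: "K n \<in> measurable M (count_space UNIV)" for n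
    unfolding K_def by measurable
  have [measurable]: "e k \<in> borel_measurable circle" for k
    by (rule circle_bounded_measurable[OF e])
  define u where "u n p = e (K n (fst p)) (snd p)" for n and p :: "'a \<times> complex"
  \<comment> \<open>\<open>K n\<close> takes countably many values, so \<open>u n\<close> is glued
    from the measurable functions \<open>e k\<close> over countably many pieces.\<close>
  have u: "u n \<in> borel_measurable (M \<Otimes>\<^sub>M circle)" for n
    unfolding u_def by (rule measurable_compose_countable) measurable
  \<comment> \<open>\<open>lim\<close> is unspecified where the sequence diverges. For each
    \<open>\<omega>\<close> in \<open>space M\<close> that is a null set of \<open>z\<close>, and
    measurability of \<open>\<phi>\<close> holds regardless.\<close>
  define \<phi> where "\<phi> p = lim (\<lambda>n. u n p)" for p
  have \<phi>: "\<phi> \<in> borel_measurable (M \<Otimes>\<^sub>M circle)"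
    unfolding \<phi>_def by (intro borel_measurable_lim_metric u)
  have *: "square_integrable (\<lambda>z. \<phi> (\<omega>, z)) \<and> abs_l2_circle (\<lambda>z. \<phi> (\<omega>, z)) = h \<omega>"
    if \<omega>: "\<omega> \<in> space M" for \<omega>
  proof -
    obtain f where f: "square_integrable f" "h \<omega> = abs_l2_circle f"
      by (rule l2_circle_cases)
    have "AE z in circle. (\<lambda>n. e (K n \<omega>) z) \<longlonglongrightarrow> f z"
    proof (rule AE_tendsto_of_norm_le_half_power[OF f(1)])
      show "square_integrable (e (K n \<omega>))" for n
        by (rule square_integrable_circle_bounded[OF e])
      show "norm (abs_l2_circle (e (K n \<omega>)) - abs_l2_circle f) \<le> (1/2) ^ n" for n
        using K_le[of \<omega> n] by (simp add: E_def f(2) norm_minus_commute)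
    qed
    then have AE: "AE z in circle. \<phi> (\<omega>, z) = f z"
      by eventually_elim (simp add: \<phi>_def u_def limI)
    have m: "(\<lambda>z. \<phi> (\<omega>, z)) \<in> borel_measurable circle"
      using measurable_compose[OF measurable_Pair1'[OF \<omega>] \<phi>] .
    have "integrable circle (\<lambda>z. (cmod (\<phi> (\<omega>, z)))\<^sup>2)"
      using f(1) m AE
      by (subst integrable_cong_AE[where g = "\<lambda>z. (cmod (f z))\<^sup>2"]) (auto simp: square_integrable_def)
    then have "square_integrable (\<lambda>z. \<phi> (\<omega>, z))"
      using m by (simp add: square_integrable_def)
    with AE f show ?thesis by (simp add: abs_l2_circle_eq_iff)
  qed
  then show ?thesis using that[OF \<phi>] by blast
qed

section \<open>The commutant of the shift\<close>

text \<open>The symbols whose multiplication commutes with \<open>T\<close> form a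
  \<open>circle_function_class\<close>: the shift gives \<open>z\<close>, its inverse gives
  \<open>cnj\<close>, and limits pass through by continuity of \<open>T\<close>.\<close>

lemma commutes_with_multiplication:
  assumes T: "T \<in> bounded_operators" and W: "T \<circ> circle_shift = circle_shift \<circ> T"
    and g: "circle_bounded g"
  shows "T (mult_l2 g x) = mult_l2 g (T x)"
proof -
  have lin: "bounded_linear T" and C: "\<And>c x. T (scaleC c x) = scaleC c (T x)"
    using T by (auto simp: bounded_operators_def)
  have id: "T (mult_l2 (\<lambda>z. z) x) = mult_l2 (\<lambda>z. z) (T x)" for x
    using fun_cong[OF W, of x] by (simp add: circle_shift_def)
  interpret circle_function_class "\<lambda>g. \<forall>x. T (mult_l2 g x) = mult_l2 g (T x)"
  proof
    show "\<forall>x. T (mult_l2 (\<lambda>_. c) x) = mult_l2 (\<lambda>_. c) (T x)" for c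
      by (simp add: mult_l2_const C)
    show "\<forall>x. T (mult_l2 (\<lambda>z. z) x) = mult_l2 (\<lambda>z. z) (T x)"
      by (simp add: id)
    show "\<forall>x. T (mult_l2 cnj x) = mult_l2 cnj (T x)"
    proof
      fix x
      \<comment> \<open>Writing \<open>x\<close> as the shift of \<open>mult_l2 cnj x\<close> lets
        the shift be moved across \<open>T\<close> and cancelled.\<close>
      have "mult_l2 cnj (T x) = mult_l2 cnj (T (mult_l2 (\<lambda>z. z) (mult_l2 cnj x)))"
        by (simp add: mult_l2_id_cnj)
      also have "\<dots> = mult_l2 (\<lambda>z. z) (mult_l2 cnj (T (mult_l2 cnj x)))"
        unfolding id by (intro mult_l2_commute circle_bounded_id circle_bounded_cnj)
      finally show "T (mult_l2 cnj x) = mult_l2 cnj (T x)"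
        by (simp add: mult_l2_id_cnj)
    qed
  next
    fix s :: "nat \<Rightarrow> complex \<Rightarrow> complex" and f B
    assume s: "\<And>n. circle_bounded (s n)" "\<And>n. \<forall>x. T (mult_l2 (s n) x) = mult_l2 (s n) (T x)"
      "circle_bounded f" "\<And>n z. cmod z = 1 \<Longrightarrow> cmod (s n z) \<le> B"
      "\<And>z. cmod z = 1 \<Longrightarrow> (\<lambda>n. s n z) \<longlonglongrightarrow> f z"
    show "\<forall>x. T (mult_l2 f x) = mult_l2 f (T x)"
    proof
      fix x
      have lim: "(\<lambda>n. mult_l2 (s n) y) \<longlonglongrightarrow> mult_l2 f y" for y
        by (rule mult_l2_tendsto[of s f B]) (fact s)+
      have "(\<lambda>n. T (mult_l2 (s n) x)) \<longlonglongrightarrow> T (mult_l2 f x)"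
        by (rule bounded_linear.tendsto[OF lin lim])
      then have "(\<lambda>n. mult_l2 (s n) (T x)) \<longlonglongrightarrow> T (mult_l2 f x)"
        by (simp add: s(2))
      with lim[of "T x"] show "T (mult_l2 f x) = mult_l2 f (T x)"
        using LIMSEQ_unique by blast
    qed
  qed (simp_all add: mult_l2_add mult_l2_mult linear_simps[OF lin])
  show ?thesis using bounded_measurable[OF g] by blast
qed

text \<open>
  Testing the operator bound against the indicator of \<open>{z. cmod (f z) > K}\<close>.
\<close>

lemma symbol_essentially_bounded:
  assumes T: "bounded_linear T"
    and comm: "\<And>g x. circle_bounded g \<Longrightarrow> T (mult_l2 g x) = mult_l2 g (T x)"
    and f: "square_integrable f" "T (abs_l2_circle (\<lambda>_. 1)) = abs_l2_circle f"
  shows "\<exists>K. AE z in circle. cmod (f z) \<le> K"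
proof -
  obtain K where K: "K > 0" "\<And>x. norm (T x) \<le> norm x * K"
    using bounded_linear.pos_bounded[OF T] by blast
  note [measurable] = square_integrable_measurable[OF f(1)]
  define g :: "complex \<Rightarrow> complex" where "g z = (if cmod (f z) > K then 1 else 0)" for z
  have "g \<in> borel_measurable circle" unfolding g_def by measurable
  then have g: "circle_bounded g"
    by (rule circle_boundedI[where B = 1]) (simp add: g_def)
  then have sg: "square_integrable g" and sgf: "square_integrable (\<lambda>z. g z * f z)"
    using f(1) by (simp_all add: square_integrable_circle_bounded square_integrable_circle_bounded_mult)
  have "T (abs_l2_circle g) = abs_l2_circle (\<lambda>z. g z * f z)"
    using comm[OF g, of "abs_l2_circle (\<lambda>_. 1)"] g f
    by (simp add: mult_l2_one mult_l2_abs_l2_circle)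
  then have "(norm (abs_l2_circle (\<lambda>z. g z * f z)))\<^sup>2 \<le> (norm (abs_l2_circle g) * K)\<^sup>2"
    using K(2)[of "abs_l2_circle g"] by (intro power_mono) auto
  then have le: "(LINT z|circle. (cmod (g z * f z))\<^sup>2) \<le> (LINT z|circle. (cmod (g z))\<^sup>2) * K\<^sup>2"
    by (simp add: norm_abs_l2_circle sg sgf power_mult_distrib)
  have int: "integrable circle (\<lambda>z. (cmod (g z * f z))\<^sup>2)" "integrable circle (\<lambda>z. (cmod (g z))\<^sup>2 * K\<^sup>2)"
    using sg sgf by (simp_all add: square_integrable_def)
  \<comment> \<open>\<open>d\<close> is positive where \<open>cmod (f z) > K\<close> and 0
    elsewhere, while the operator bound makes its integral at most 0; hence that set is
    null.\<close>
  define d where "d z = (cmod (g z * f z))\<^sup>2 - (cmod (g z))\<^sup>2 * K\<^sup>2" for z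
  have d_pos: "d z > 0" if "cmod (f z) > K" for z
    using that K(1) by (simp add: d_def g_def power_strict_mono)
  have d_nonneg: "d z \<ge> 0" for z
    using d_pos[of z] by (cases "cmod (f z) > K") (auto simp: d_def g_def)
  have d_int: "integrable circle d"
    unfolding d_def using int by simp
  have "integral\<^sup>L circle d \<le> 0"
    unfolding d_def using le int by simp
  moreover have "integral\<^sup>L circle d \<ge> 0"
    by (intro integral_nonneg_AE) (simp add: d_nonneg)
  ultimately have "AE z in circle. d z = 0"
    using integral_nonneg_eq_0_iff_AE[OF d_int] d_nonneg by auto
  then have "AE z in circle. cmod (f z) \<le> K"
    by eventually_elim (use d_pos in \<open>force simp: not_less[symmetric]\<close>)
  then show ?thesis by blast
qed

text \<open>An operator commuting with all multiplications is determined by its value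
  \<open>g\<close> at 1: on a bounded function \<open>e\<close> both operators give
  \<open>e * g\<close>, and such functions are dense.\<close>

lemma eq_mult_l2I:
  assumes T: "bounded_linear T"
    and comm: "\<And>g x. circle_bounded g \<Longrightarrow> T (mult_l2 g x) = mult_l2 g (T x)"
    and g: "circle_bounded g" and one: "T (abs_l2_circle (\<lambda>_. 1)) = abs_l2_circle g"
  shows "T = mult_l2 g"
proof
  fix x
  obtain e :: "nat \<Rightarrow> complex \<Rightarrow> complex" where e: "\<And>k. circle_bounded (e k)"
      and dense: "closure (range (\<lambda>k. abs_l2_circle (e k))) = UNIV"
    by (rule l2_circle_dense_sequence) blast
  have "T (abs_l2_circle (e k)) = mult_l2 g (abs_l2_circle (e k))" for k
    using comm[OF e, of k "abs_l2_circle (\<lambda>_. 1)"] mult_l2_commute[OF e g, of k "abs_l2_circle (\<lambda>_. 1)"]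
    by (simp add: mult_l2_one e g one)
  moreover have "closed {x. T x = mult_l2 g x}"
    by (intro closed_Collect_eq linear_continuous_on T bounded_linear_mult_l2 g)
  ultimately have "closure (range (\<lambda>k. abs_l2_circle (e k))) \<subseteq> {x. T x = mult_l2 g x}"
    by (intro closure_minimal) auto
  then show "T x = mult_l2 g x" using dense by auto
qed

section \<open>The two inclusions\<close>

text \<open>Weak measurability is the main point: the inner product is a parameter integral of a
  jointly measurable function.\<close>

lemma laurent_in_commutant:
  assumes \<phi>: "\<phi> \<in> borel_measurable (M \<Otimes>\<^sub>M circle)"
    and bdd: "\<And>\<omega>. \<omega> \<in> space M \<Longrightarrow> bounded ((\<lambda>z. \<phi> (\<omega>, z)) ` sphere 0 1)"
  shows "laurent M \<phi> \<in> random_commutant M circle_shift"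
proof -
  \<comment> \<open>Finiteness supplies the sigma-finiteness that measurability of parameter
    integrals over \<open>circle\<close> requires.\<close>
  interpret circle: finite_measure circle by (rule finite_measure_circle)
  have b: "circle_bounded (\<lambda>z. \<phi> (\<omega>, z))" if \<omega>: "\<omega> \<in> space M" for \<omega>
    using measurable_compose[OF measurable_Pair1'[OF \<omega>] \<phi>] bdd[OF \<omega>] by (simp add: circle_bounded_def)
  have "(\<lambda>\<omega>. cinner (laurent M \<phi> \<omega> x) y) \<in> borel_measurable M" for x y
  proof -
    obtain f g where f: "square_integrable f" "x = abs_l2_circle f"
      and g: "square_integrable g" "y = abs_l2_circle g"
      using l2_circle_cases by metis
    note [measurable] = \<phi> square_integrable_measurable[OF f(1)] square_integrable_measurable[OF g(1)]
    have [measurable]: "cnj \<in> borel_measurable borel"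
      by (intro borel_measurable_continuous_onI continuous_intros)
    have "(\<lambda>\<omega>. LINT z|circle. \<phi> (\<omega>, z) * f z * cnj (g z)) \<in> borel_measurable M"
      by measurable
    moreover have "cinner (laurent M \<phi> \<omega> x) y = (LINT z|circle. \<phi> (\<omega>, z) * f z * cnj (g z))"
      if "\<omega> \<in> space M" for \<omega>
      using that f g b[OF that] square_integrable_circle_bounded_mult[OF b[OF that] f(1)]
      by (simp add: laurent_def mult_l2_abs_l2_circle cinner.abs_eq l2_rel_def)
    ultimately show ?thesis by (simp cong: measurable_cong)
  qed
  then show ?thesis
    using b mult_l2_bounded_operators
    by (auto simp: random_commutant_def random_operators_def laurent_def circle_shift_def fun_eq_iff
        mult_l2_commute circle_bounded_id)
qed

text \<open>Representing the image of 1 yields a symbol \<open>\<phi>\<close> known only to be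
  essentially bounded for each \<open>\<omega>\<close>. Truncation at a measurable integer height
  gives \<open>\<psi>\<close>, bounded at every point and with the same classes.\<close>

lemma commutant_is_laurent:
  assumes A: "A \<in> random_commutant M circle_shift"
  obtains \<phi> where "\<phi> \<in> borel_measurable (M \<Otimes>\<^sub>M circle)"
    "\<And>\<omega>. \<omega> \<in> space M \<Longrightarrow> bounded ((\<lambda>z. \<phi> (\<omega>, z)) ` sphere 0 1)" "A = laurent M \<phi>"
proof -
  interpret circle: finite_measure circle by (rule finite_measure_circle)
  have ext: "A \<in> extensional (space M)" and op: "\<And>\<omega>. \<omega> \<in> space M \<Longrightarrow> A \<omega> \<in> bounded_operators"
    and meas: "\<And>x y. (\<lambda>\<omega>. cinner (A \<omega> x) y) \<in> borel_measurable M"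
    and W: "\<And>\<omega>. \<omega> \<in> space M \<Longrightarrow> A \<omega> \<circ> circle_shift = circle_shift \<circ> A \<omega>"
    using A by (auto simp: random_commutant_def random_operators_def PiE_def)
  have lin: "bounded_linear (A \<omega>)" if "\<omega> \<in> space M" for \<omega>
    using op[OF that] by (simp add: bounded_operators_def)
  have comm: "A \<omega> (mult_l2 g x) = mult_l2 g (A \<omega> x)" if "\<omega> \<in> space M" "circle_bounded g" for \<omega> g x
    by (rule commutes_with_multiplication[OF op[OF that(1)] W[OF that(1)] that(2)])
  obtain \<phi> where \<phi>: "\<phi> \<in> borel_measurable (M \<Otimes>\<^sub>M circle)"
    and sq: "\<And>\<omega>. \<omega> \<in> space M \<Longrightarrow> square_integrable (\<lambda>z. \<phi> (\<omega>, z))"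
    and rep: "\<And>\<omega>. \<omega> \<in> space M \<Longrightarrow> abs_l2_circle (\<lambda>z. \<phi> (\<omega>, z)) = A \<omega> (abs_l2_circle (\<lambda>_. 1))"
    using measurable_representative[of "\<lambda>\<omega>. A \<omega> (abs_l2_circle (\<lambda>_. 1))" M] meas by blast
  define E where "E n = {p \<in> space (M \<Otimes>\<^sub>M circle). cmod (\<phi> p) > real n}" for n :: nat
  \<comment> \<open>The least integer essential bound of \<open>\<phi>\<close> at
    \<open>\<omega>\<close>. It is measurable because the measure of a section of \<open>E n\<close>
    depends measurably on \<open>\<omega>\<close>.\<close>
  define N where "N \<omega> = (LEAST n. emeasure circle (Pair \<omega> -` E n) = 0)" for \<omega>
  define \<psi> where "\<psi> p = (if cmod (\<phi> p) \<le> real (N (fst p)) then \<phi> p else 0)" for p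
  note [measurable] = \<phi>
  have E: "E n \<in> sets (M \<Otimes>\<^sub>M circle)" for n
    unfolding E_def by measurable
  have [measurable]: "(\<lambda>\<omega>. emeasure circle (Pair \<omega> -` E n)) \<in> borel_measurable M" for n
    by (rule circle.measurable_emeasure_Pair[OF E])
  have [measurable]: "N \<in> measurable M (count_space UNIV)"
    unfolding N_def by measurable
  have \<psi>: "\<psi> \<in> borel_measurable (M \<Otimes>\<^sub>M circle)"
    unfolding \<psi>_def by measurable
  \<comment> \<open>The truncation enforces this bound whatever value \<open>LEAST\<close> returns;
    essential boundedness serves to show that it changes nothing almost everywhere.\<close>
  have \<psi>_le: "cmod (\<psi> (\<omega>, z)) \<le> real (N \<omega>)" for \<omega> z
    by (simp add: \<psi>_def)
  have "A \<omega> = mult_l2 (\<lambda>z. \<psi> (\<omega>, z))" if \<omega>: "\<omega> \<in> space M" for \<omega>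
  proof -
    have null: "emeasure circle (Pair \<omega> -` E n) = 0 \<longleftrightarrow> (AE z in circle. cmod (\<phi> (\<omega>, z)) \<le> real n)" for n
    proof -
      have "Pair \<omega> -` E n = {z \<in> space circle. \<not> cmod (\<phi> (\<omega>, z)) \<le> real n}"
        using \<omega> by (auto simp: E_def space_pair_measure)
      then show ?thesis
        using sets_Pair1[OF E, of \<omega> n] by (subst AE_iff_measurable) auto
    qed
    obtain K where K: "AE z in circle. cmod (\<phi> (\<omega>, z)) \<le> K"
      using symbol_essentially_bounded[OF lin[OF \<omega>] comm[OF \<omega>] sq[OF \<omega>] rep[OF \<omega>, symmetric]] by blast
    obtain n :: nat where "K \<le> real n" using real_arch_simple by blast
    with K have "AE z in circle. cmod (\<phi> (\<omega>, z)) \<le> real n"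
      by (auto elim: eventually_mono)
    then have "\<exists>n. emeasure circle (Pair \<omega> -` E n) = 0"
      using null by blast
    then have "emeasure circle (Pair \<omega> -` E (N \<omega>)) = 0"
      unfolding N_def by (rule LeastI_ex)
    then have "AE z in circle. cmod (\<phi> (\<omega>, z)) \<le> real (N \<omega>)"
      by (simp add: null)
    then have AE: "AE z in circle. \<phi> (\<omega>, z) = \<psi> (\<omega>, z)"
      by eventually_elim (simp add: \<psi>_def)
    have b: "circle_bounded (\<lambda>z. \<psi> (\<omega>, z))"
      using measurable_compose[OF measurable_Pair1'[OF \<omega>] \<psi>] \<psi>_le by (rule circle_boundedI)
    have "A \<omega> (abs_l2_circle (\<lambda>_. 1)) = abs_l2_circle (\<lambda>z. \<psi> (\<omega>, z))"
      unfolding rep[OF \<omega>, symmetric] using AE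
      by (simp add: abs_l2_circle_eq_iff sq[OF \<omega>] square_integrable_circle_bounded[OF b])
    from eq_mult_l2I[OF lin[OF \<omega>] comm[OF \<omega>] b this] show ?thesis .
  qed
  \<comment> \<open>Off \<open>space M\<close> both sides are \<open>undefined\<close>, so agreement
    on \<open>space M\<close> suffices.\<close>
  then have "A = laurent M \<psi>"
    using ext by (auto simp: laurent_def fun_eq_iff restrict_def extensional_def)
  moreover have "bounded ((\<lambda>z. \<psi> (\<omega>, z)) ` sphere 0 1)" for \<omega>
    using \<psi>_le by (auto simp: bounded_iff)
  ultimately show ?thesis using that[OF \<psi>] by blast
qed

theorem theorem13:
  fixes M :: "'a measure"
  assumes "prob_space M"
  shows "random_commutant M circle_shift =
    {laurent M \<phi> | \<phi>. \<phi> \<in> borel_measurable (M \<Otimes>\<^sub>M circle) \<and>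
      (\<forall>\<omega>\<in>space M. bounded ((\<lambda>z. \<phi> (\<omega>, z)) ` sphere 0 1))}"
  by (auto intro: laurent_in_commutant elim: commutant_is_laurent)

end
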